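(* Let $n\ge 1$, let $p\in S^{2n+1}=\{(z_0,\ldots,z_n)\in\mathbb{C}^{n+1}:|z_0|^2+\cdots+|z_n|^2=1\}$ and let $v\in T_pS^{2n+1}$. Let $\gamma_R(t)=(z_0(t),\ldots,z_n(t))$ be the great circle (Riemannian geodesic of the round sphere) with $\gamma_R(0)=p$ and $\dot\gamma_R(0)=v$. Then the sub-Riemannian geodesic corresponding to $\gamma_R$, i.e. the horizontal lift starting at $p$ of the projection of $\gamma_R$ to $\mathbb{C}P^n$ under the Hopf map, which is a normal sub-Riemannian geodesic of $(S^{2n+1},\mathcal{H},\langle\cdot,\cdot\rangle|_{\mathcal H})$, is given by $$\gamma(t)=\left(z_0(t)e^{-it\langle v,V_{n+1}(p)\rangle},\ldots,z_n(t)e^{-it\langle v,V_{n+1}(p)\rangle}\right).$$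
   Context: Identify $\mathbb{C}^{n+1}\cong\mathbb{R}^{2(n+1)}$ with standard inner product $\langle\cdot,\cdot\rangle$ (the real part of the standard Hermitian product). For $p\in S^{2n+1}$ put $V_{n+1}(p)=i\cdot p=(ip_0,\ldots,ip_n)\in T_pS^{2n+1}$; in real coordinates $V_{n+1}=\sum_k(-y_k\partial_{x_k}+x_k\partial_{y_k})$. The group $S^1$ acts on $S^{2n+1}$ by componentwise multiplication by unit complex numbers, and the quotient map is the Hopf map $\pi:S^{2n+1}\to\mathbb{C}P^n$. The horizontal distribution is $\mathcal{H}_p=\{w\in T_pS^{2n+1}:\langle w,V_{n+1}(p)\rangle=0\}$, with sub-Riemannian metric the restriction of $\langle\cdot,\cdot\rangle$. A curve is horizontal if its velocity lies in $\mathcal H$; a horizontal lift of a curve $c$ in $\mathbb{C}P^n$ is a horizontal curve $\gamma$ in $S^{2n+1}$ with $\pi\circ\gamma=c$. A normal sub-Riemannian geodesic is the projection to the manifold of a solution of the Hamiltonian system on the cotangent bundle with Hamiltonian $H(q,\lambda)=\frac12\sum_m\lambda(X_m(q))^2$, where $X_1,X_2,\ldots$ is any local orthonormal frame of $\mathcal H$. The great circle with $\gamma_R(0)=p$, $\dot\gamma_R(0)=v\neq0$ is $\gamma_R(t)=p\cos(\|v\|t)+\frac{v}{\|v\|}\sin(\|v\|t)$ (constant if $v=0$). *)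

theory Defs
  imports "HOL-Analysis.Analysis"
begin

text \<open>
  The space of (n+1)-tuples of complex numbers is \<open>complex ^ 'n\<close> with \<open>CARD('n) = n + 1\<close>.  Its library
  inner product is the real part of the standard Hermitian product, and \<open>u *s p\<close> is componentwise
  multiplication by the complex number \<open>u\<close>.
\<close>

abbreviation S :: "(complex ^ 'n::finite) set" where
  "S \<equiv> sphere 0 1"

definition tangent :: "complex ^ 'n::finite \<Rightarrow> (complex ^ 'n) set" where
  "tangent p = {w. p \<bullet> w = 0}"

definition Vfield :: "complex ^ 'n::finite \<Rightarrow> complex ^ 'n" where
  "Vfield p = \<i> *s p"

definition horizontal :: "complex ^ 'n::finite \<Rightarrow> (complex ^ 'n) set" where
  "horizontal p = {w \<in> tangent p. w \<bullet> Vfield p = 0}"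

definition great_circle :: "complex ^ 'n::finite \<Rightarrow> complex ^ 'n \<Rightarrow> real \<Rightarrow> complex ^ 'n" where
  "great_circle p v t =
     (if v = 0 then p
      else cos (norm v * t) *\<^sub>R p + sin (norm v * t) *\<^sub>R ((1 / norm v) *\<^sub>R v))"

text \<open>Complex projective space is the orbit space of the circle action on the sphere; the Hopf map sends a
  point to its orbit.\<close>

definition hopf :: "complex ^ 'n::finite \<Rightarrow> (complex ^ 'n) set" where
  "hopf p = {u *s p |u. cmod u = 1}"

definition horizontal_curve :: "(real \<Rightarrow> complex ^ 'n::finite) \<Rightarrow> bool" where
  "horizontal_curve \<gamma> \<longleftrightarrow>
     (\<forall>t. \<gamma> t \<in> S \<and> (\<exists>w \<in> horizontal (\<gamma> t). (\<gamma> has_vector_derivative w) (at t)))"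

definition horizontal_lift ::
  "(real \<Rightarrow> complex ^ 'n::finite) \<Rightarrow> (real \<Rightarrow> (complex ^ 'n) set) \<Rightarrow> bool" where
  "horizontal_lift \<gamma> c \<longleftrightarrow> horizontal_curve \<gamma> \<and> hopf \<circ> \<gamma> = c"

text \<open>
  A covector at a point \<open>q\<close> of the sphere is a linear functional on \<open>tangent q\<close>.  It is represented by its
  unique linear extension to the ambient space that vanishes at the normal vector \<open>q\<close>; this makes the
  cotangent bundle an embedded submanifold of the product of the ambient space with its dual.
\<close>

definition cotangent_bundle ::
  "((complex ^ 'n::finite) \<times> ((complex ^ 'n) \<Rightarrow>\<^sub>L real)) set" where
  "cotangent_bundle = {(q, l). q \<in> S \<and> blinfun_apply l q = 0}"

text \<open>The tangent space of an embedded submanifold: velocities of curves in it.\<close>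

definition velocities :: "'a::real_normed_vector set \<Rightarrow> 'a \<Rightarrow> 'a set" where
  "velocities M x =
     {\<eta>. \<exists>c. (\<forall>s::real. c s \<in> M) \<and> c 0 = x \<and> (c has_vector_derivative \<eta>) (at 0)}"

text \<open>The tautological one-form at \<open>(q, l)\<close> evaluates \<open>l\<close> on the base component of a tangent vector.
  The canonical symplectic form is minus its exterior derivative.  Both are written on the ambient space;
  exterior differentiation commutes with restriction to the cotangent bundle.\<close>

definition tautological_form :: "'a::real_normed_vector \<times> ('a \<Rightarrow>\<^sub>L real) \<Rightarrow> 'a \<times> ('a \<Rightarrow>\<^sub>L real) \<Rightarrow> real" where
  "tautological_form x \<eta> = blinfun_apply (snd x) (fst \<eta>)"

definition ext_deriv ::
  "('a::real_normed_vector \<Rightarrow> 'a \<Rightarrow> real) \<Rightarrow> 'a \<Rightarrow> 'a \<Rightarrow> 'a \<Rightarrow> real" where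
  "ext_deriv \<theta> x \<xi> \<eta> =
     frechet_derivative (\<lambda>y. \<theta> y \<eta>) (at x) \<xi> - frechet_derivative (\<lambda>y. \<theta> y \<xi>) (at x) \<eta>"

definition symplectic_form ::
  "'a::real_normed_vector \<times> ('a \<Rightarrow>\<^sub>L real) \<Rightarrow> 'a \<times> ('a \<Rightarrow>\<^sub>L real) \<Rightarrow> 'a \<times> ('a \<Rightarrow>\<^sub>L real) \<Rightarrow> real" where
  "symplectic_form x \<xi> \<eta> = - ext_deriv tautological_form x \<xi> \<eta>"

lemma symplectic_form_eq:
  "symplectic_form x \<xi> \<eta> = blinfun_apply (snd \<eta>) (fst \<xi>) - blinfun_apply (snd \<xi>) (fst \<eta>)"
proof -
  have "((\<lambda>y. tautological_form y \<zeta>) has_derivative (\<lambda>h. blinfun_apply (snd h) (fst \<zeta>))) (at x)"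
    for \<zeta> :: "'a \<times> ('a \<Rightarrow>\<^sub>L real)"
    unfolding tautological_form_def by (auto intro!: derivative_eq_intros)
  then have "frechet_derivative (\<lambda>y. tautological_form y \<zeta>) (at x) = (\<lambda>h. blinfun_apply (snd h) (fst \<zeta>))"
    for \<zeta> :: "'a \<times> ('a \<Rightarrow>\<^sub>L real)"
    using frechet_derivative_at by metis
  then show ?thesis
    by (simp add: symplectic_form_def ext_deriv_def)
qed

text \<open>A solution of the Hamiltonian system of \<open>H\<close> on the cotangent bundle: its velocity at each time is the
  Hamiltonian vector, i.e. its contraction with the symplectic form is the differential of \<open>H\<close>.  The
  derivative \<open>D\<close> of \<open>H\<close> within the cotangent bundle is determined on the vectors tangent to it, and only
  its values there are used.  The sign of the symplectic form makes this \<open>q' = \<partial>H/\<partial>l\<close>, \<open>l' = - \<partial>H/\<partial>q\<close> in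
  canonical coordinates.\<close>

definition hamiltonian_solution ::
  "((complex ^ 'n::finite) \<times> ((complex ^ 'n) \<Rightarrow>\<^sub>L real) \<Rightarrow> real) \<Rightarrow>
   (real \<Rightarrow> (complex ^ 'n) \<times> ((complex ^ 'n) \<Rightarrow>\<^sub>L real)) \<Rightarrow> bool" where
  "hamiltonian_solution H x \<longleftrightarrow>
     (\<forall>t. x t \<in> cotangent_bundle \<and>
        (\<exists>\<xi> D. (x has_vector_derivative \<xi>) (at t) \<and>
               (H has_derivative D) (at (x t) within cotangent_bundle) \<and>
               (\<forall>\<eta> \<in> velocities cotangent_bundle (x t). symplectic_form (x t) \<xi> \<eta> = D \<eta>)))"

definition orthonormal_basis :: "'a::real_inner set \<Rightarrow> 'a set \<Rightarrow> bool" where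
  "orthonormal_basis B W \<longleftrightarrow> pairwise orthogonal B \<and> (\<forall>b\<in>B. norm b = 1) \<and> span B = W"

text \<open>The value of the sub-Riemannian Hamiltonian at a point depends on a local orthonormal frame of the
  horizontal distribution only through its values at that point, and not on their choice: see
  \<open>sR_hamiltonian_frame\<close> below.\<close>

definition sR_hamiltonian ::
  "(complex ^ 'n::finite) \<times> ((complex ^ 'n) \<Rightarrow>\<^sub>L real) \<Rightarrow> real" where
  "sR_hamiltonian x =
     1/2 * (\<Sum>b \<in> (SOME B. orthonormal_basis B (horizontal (fst x))). (blinfun_apply (snd x) b)\<^sup>2)"

lemma orthonormal_basis_sum_squares:
  fixes B C :: "'a::euclidean_space set" and l :: "'a \<Rightarrow>\<^sub>L real"
  assumes "orthonormal_basis B W" "orthonormal_basis C W"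
  shows "(\<Sum>b\<in>B. (blinfun_apply l b)\<^sup>2) = (\<Sum>c\<in>C. (blinfun_apply l c)\<^sup>2)"
proof -
  define P where "P A = (\<Sum>a\<in>A. blinfun_apply l a *\<^sub>R a)" for A :: "'a set"
  have l_P: "blinfun_apply l (P A) = (\<Sum>a\<in>A. (blinfun_apply l a)\<^sup>2)" for A
    by (simp add: P_def blinfun.sum_right blinfun.scaleR_right power2_eq_square)
  have P_in: "P A \<in> W" and P_inner: "w \<in> W \<Longrightarrow> P A \<bullet> w = blinfun_apply l w"
    if A: "orthonormal_basis A W" for A w
  proof -
    from A have orth: "pairwise orthogonal A" and nrm: "\<And>a. a \<in> A \<Longrightarrow> norm a = 1"
      and sp: "span A = W"
      by (auto simp: orthonormal_basis_def)
    have fin: "finite A"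
      using orth by (rule pairwise_orthogonal_imp_finite)
    show "P A \<in> W"
      unfolding P_def sp[symmetric] by (intro span_sum span_scale span_base)
    have base: "P A \<bullet> a = blinfun_apply l a" if a: "a \<in> A" for a
    proof -
      have "P A \<bullet> a = (\<Sum>b\<in>A. if b = a then blinfun_apply l a else 0)"
        unfolding P_def inner_sum_left
        using orth nrm[OF a] a
        by (intro sum.cong) (auto simp: pairwise_def orthogonal_def norm_eq_1)
      also have "\<dots> = blinfun_apply l a"
        using fin a by simp
      finally show ?thesis .
    qed
    assume "w \<in> W"
    then have "w \<in> span A" by (simp add: sp)
    then show "P A \<bullet> w = blinfun_apply l w"
      by (induction rule: span_induct_alt)
        (simp_all add: base inner_add_right blinfun.add_right blinfun.scaleR_right)
  qed
  have "P B - P C \<in> W"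
    using P_in assms span_diff unfolding orthonormal_basis_def by metis
  then have "P B \<bullet> (P B - P C) = P C \<bullet> (P B - P C)"
    using P_inner assms by metis
  then have "(P B - P C) \<bullet> (P B - P C) = 0"
    by (simp add: inner_diff_left)
  then have "P B = P C" by simp
  then show ?thesis using l_P by metis
qed

lemma sR_hamiltonian_frame:
  fixes X :: "'i \<Rightarrow> complex ^ 'n::finite \<Rightarrow> complex ^ 'n"
  assumes "\<forall>i\<in>I. \<forall>j\<in>I. X i q \<bullet> X j q = (if i = j then 1 else 0)"
    and "span ((\<lambda>i. X i q) ` I) = horizontal q"
  shows "sR_hamiltonian (q, l) = 1/2 * (\<Sum>i\<in>I. (blinfun_apply l (X i q))\<^sup>2)"
proof -
  let ?B = "(\<lambda>i. X i q) ` I"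
  have inj: "inj_on (\<lambda>i. X i q) I"
    using assms(1) by (auto simp: inj_on_def) (metis zero_neq_one)
  have B: "orthonormal_basis ?B (horizontal q)"
    using assms by (auto simp: orthonormal_basis_def pairwise_def orthogonal_def norm_eq_1)
  then have "orthonormal_basis (SOME B. orthonormal_basis B (horizontal q)) (horizontal q)"
    by (rule someI)
  from orthonormal_basis_sum_squares[OF this B]
  show ?thesis
    by (simp add: sR_hamiltonian_def sum.reindex[OF inj] o_def)
qed

definition normal_geodesic :: "(real \<Rightarrow> complex ^ 'n::finite) \<Rightarrow> bool" where
  "normal_geodesic \<gamma> \<longleftrightarrow> (\<exists>l. hamiltonian_solution sR_hamiltonian (\<lambda>t. (\<gamma> t, l t)))"

end

theory Submission imports Defs begin

text \<open>
  Put \<open>a = \<langle>v, V p\<rangle>\<close>.  The function \<open>\<langle>R', V R\<rangle>\<close> is constant along the great circle \<open>R\<close>, so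
  it equals \<open>a\<close>, and multiplying \<open>R\<close> by \<open>exp (-i a t)\<close> subtracts exactly the vertical part of its
  velocity.  For a covector represented by a vector \<open>m\<close> orthogonal to \<open>q\<close>, the sub-Riemannian
  Hamiltonian is \<open>(|m|\<^sup>2 - \<langle>m, V q\<rangle>\<^sup>2) / 2\<close>.  The first summand generates the great circles and the
  second one the circle action; the two flows commute, so \<open>m = exp (-i a t) R'\<close> is the covector along
  the lift.
\<close>

section \<open>Scalar multiplication and the vertical field\<close>

lemma vector_scalar_mult_nth: "(c *s x) $ k = c * x $ k"
  by (simp add: vector_scalar_mult_def)

lemma bounded_bilinear_vector_scalar_mult:
  "bounded_bilinear ((*s) :: complex \<Rightarrow> complex ^ 'n::finite \<Rightarrow> complex ^ 'n)"
  by (subst bilinear_conv_bounded_bilinear[symmetric])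
     (auto simp: bilinear_def vec_eq_iff vector_scalar_mult_nth algebra_simps intro!: linearI)

lemma inner_unit_mult:
  fixes x y :: "complex ^ 'n::finite"
  assumes "cmod c = 1"
  shows "(c *s x) \<bullet> (c *s y) = x \<bullet> y"
proof -
  have "(c * z) \<bullet> (c * w) = z \<bullet> w" for z w :: complex
  proof -
    have "(c * z) \<bullet> (c * w) = ((Re c)\<^sup>2 + (Im c)\<^sup>2) * (z \<bullet> w)"
      by (simp add: inner_complex_def power2_eq_square algebra_simps)
    then show ?thesis using assms by (simp flip: cmod_power2)
  qed
  then show ?thesis by (simp add: inner_vec_def vector_scalar_mult_nth)
qed

lemma norm_unit_mult: "cmod c = 1 \<Longrightarrow> norm (c *s (x :: complex ^ 'n::finite)) = norm x"
  by (simp add: norm_eq_sqrt_inner inner_unit_mult)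

lemma linear_Vfield: "linear Vfield"
  by (auto simp: Vfield_def vec_eq_iff vector_scalar_mult_nth algebra_simps intro!: linearI)

lemma bounded_linear_Vfield: "bounded_linear Vfield"
  by (simp add: linear_Vfield linear_conv_bounded_linear[symmetric])

lemmas Vfield_add = linear_add[OF linear_Vfield]
  and Vfield_scaleR = linear_cmul[OF linear_Vfield]

lemma Vfield_mult: "Vfield (c *s x) = c *s Vfield x"
  by (simp add: Vfield_def vec_eq_iff vector_scalar_mult_nth)

lemma Vfield_skew: "x \<bullet> Vfield y = - (Vfield x \<bullet> y)"
  by (simp add: Vfield_def inner_vec_def vector_scalar_mult_nth inner_complex_def flip: sum_negf)

lemma Vfield_inner_Vfield: "Vfield x \<bullet> Vfield y = x \<bullet> y"
  by (simp add: Vfield_def inner_unit_mult)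

lemma inner_Vfield_self [simp]: "x \<bullet> Vfield x = 0" "Vfield x \<bullet> x = 0"
  using Vfield_skew[of x x] by (simp_all add: inner_commute)

section \<open>The Hermitian product\<close>

definition hermitian :: "complex ^ 'n::finite \<Rightarrow> complex ^ 'n \<Rightarrow> complex" where
  "hermitian x y = (\<Sum>k\<in>UNIV. x $ k * cnj (y $ k))"

lemma hermitian_eq_Complex: "hermitian x y = Complex (x \<bullet> y) (x \<bullet> Vfield y)"
  by (simp add: complex_eq_iff hermitian_def Vfield_def inner_vec_def vector_scalar_mult_nth
      inner_complex_def)

lemma hermitian_mult_left: "hermitian (c *s x) y = c * hermitian x y"
  by (simp add: hermitian_def vector_scalar_mult_nth sum_distrib_left mult_ac)

lemma hermitian_mult_right: "hermitian x (c *s y) = cnj c * hermitian x y"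
  by (simp add: hermitian_def vector_scalar_mult_nth sum_distrib_left mult_ac)

lemma cnj_hermitian: "cnj (hermitian x y) = hermitian y x"
  by (simp add: hermitian_def mult_ac)

text \<open>Conjugate-linearity in the second argument is still linearity over the reals, which is
  all that the product rule for curves requires.\<close>

lemma bounded_bilinear_hermitian: "bounded_bilinear hermitian"
  by (subst bilinear_conv_bounded_bilinear[symmetric])
    (auto simp: bilinear_def hermitian_def algebra_simps sum.distrib scaleR_sum_right
      intro!: linearI)

lemma hermitian_self: "x \<in> S \<Longrightarrow> hermitian x x = 1"
  by (simp add: hermitian_eq_Complex complex_eq_iff norm_eq_1)

text \<open>The real part of the equation is tangency, the imaginary part is orthogonality to
  \<open>Vfield q\<close>. Combined into one complex equation, the condition visibly survives
  multiplying \<open>q\<close> by a complex scalar.\<close>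

lemma horizontal_iff_hermitian: "w \<in> horizontal q \<longleftrightarrow> hermitian w q = 0"
  by (auto simp: horizontal_def tangent_def hermitian_eq_Complex complex_eq_iff inner_commute)

section \<open>Hopf fibres and uniqueness of horizontal lifts\<close>

lemma hopf_unit_mult:
  assumes "cmod c = 1"
  shows "hopf (c *s x) = hopf x"
proof -
  have "\<exists>u'. u *s (c *s x) = u' *s x \<and> cmod u' = 1" if "cmod u = 1" for u
    using assms that by (intro exI[of _ "u * c"]) (simp add: norm_mult)
  moreover have "\<exists>u'. u *s x = u' *s (c *s x) \<and> cmod u' = 1" if "cmod u = 1" for u
    using assms that
    by (intro exI[of _ "u / c"]) (auto simp: norm_divide)
  ultimately show ?thesis by (auto simp: hopf_def)
qed

lemma hopf_eqD:
  assumes "hopf x = hopf y"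
  obtains c where "cmod c = 1" "x = c *s y"
proof -
  have "x \<in> hopf x" by (auto simp: hopf_def intro!: exI[of _ 1])
  then show ?thesis using that assms by (auto simp: hopf_def)
qed

text \<open>Two such curves differ by a unit scalar function, which can be recovered as their Hermitian
  product and hence is differentiable; horizontality makes its derivative vanish.\<close>

lemma horizontal_lift_unique:
  assumes "horizontal_lift \<delta> c" "horizontal_lift \<gamma> c" "\<delta> 0 = \<gamma> 0"
  shows "\<delta> = \<gamma>"
proof
  fix t
  define w where "w t = hermitian (\<delta> t) (\<gamma> t)" for t
  have eq: "\<delta> t = w t *s \<gamma> t" "\<gamma> t = cnj (w t) *s \<delta> t" for t
  proof -
    have "hopf (\<delta> t) = hopf (\<gamma> t)"
      using assms(1,2) by (metis horizontal_lift_def comp_apply)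
    then obtain u where u: "cmod u = 1" "\<delta> t = u *s \<gamma> t" by (rule hopf_eqD)
    have "\<gamma> t \<in> S" using assms(2) by (auto simp: horizontal_lift_def horizontal_curve_def)
    then have "w t = u" by (simp add: w_def u(2) hermitian_mult_left hermitian_self)
    moreover have "cnj u * u = 1" using u(1)
      by (simp add: mult.commute flip: complex_norm_square)
    ultimately show "\<delta> t = w t *s \<gamma> t" "\<gamma> t = cnj (w t) *s \<delta> t"
      using u(2) by simp_all
  qed
  have "(w has_vector_derivative 0) (at t)" for t
  proof -
    obtain d g where d: "d \<in> horizontal (\<delta> t)" "(\<delta> has_vector_derivative d) (at t)"
      and g: "g \<in> horizontal (\<gamma> t)" "(\<gamma> has_vector_derivative g) (at t)"
      using assms(1,2) unfolding horizontal_lift_def horizontal_curve_def by blast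
    \<comment> \<open>Both terms of the product rule for \<open>w\<close> vanish:
      \<open>\<gamma> t\<close> and \<open>\<delta> t\<close> are multiples of each other, so each
      velocity is Hermitian-orthogonal to the other curve's point as well as to its own.\<close>
    have "hermitian d (\<gamma> t) = 0"
      using d(1) by (subst eq(2)) (simp add: hermitian_mult_right horizontal_iff_hermitian)
    moreover have "hermitian (\<gamma> t) g = 0"
      using g(1) cnj_hermitian[of g "\<gamma> t"] by (simp add: horizontal_iff_hermitian)
    then have "hermitian (\<delta> t) g = 0"
      by (subst eq(1)) (simp add: hermitian_mult_left)
    ultimately show ?thesis
      using bounded_bilinear.has_vector_derivative[OF bounded_bilinear_hermitian d(2) g(2)]
      unfolding w_def by simp
  qed
  then obtain k where "w t = k" for t
    using has_vector_derivative_zero_constant[of UNIV w] by auto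
  then have "w t = w 0" by simp
  also have "w 0 = 1"
    using assms(2,3)
    by (auto simp: w_def horizontal_lift_def horizontal_curve_def intro!: hermitian_self)
  finally show "\<delta> t = \<gamma> t" using eq(1)[of t] by simp
qed

section \<open>The Hamiltonian and its differential\<close>

text \<open>An orthonormal basis of the horizontal space becomes one of the ambient space once
  \<open>q\<close> and \<open>Vfield q\<close> are added. The sum of squares over it equals that
  over \<open>Basis\<close>, and the covector kills \<open>q\<close>. The result is free of the
  choice operator and polynomial in the ambient coordinates.\<close>

lemma sR_hamiltonian_on_cotangent_bundle:
  fixes x :: "(complex ^ 'n::finite) \<times> ((complex ^ 'n) \<Rightarrow>\<^sub>L real)"
  assumes "x \<in> cotangent_bundle"
  shows "sR_hamiltonian x =
    1/2 * ((\<Sum>b\<in>Basis. (blinfun_apply (snd x) b)\<^sup>2) - (blinfun_apply (snd x) (Vfield (fst x)))\<^sup>2)"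
proof -
  obtain q l where x: "x = (q, l)" by force
  have q: "q \<bullet> q = 1" and lq: "blinfun_apply l q = 0"
    using assms by (auto simp: x cotangent_bundle_def norm_eq_1)
  have "subspace (horizontal q)"
    unfolding subspace_def by (auto simp: horizontal_def tangent_def inner_add)
  then obtain B where B: "orthonormal_basis B (horizontal q)"
    using orthonormal_basis_subspace[of "horizontal q"] unfolding orthonormal_basis_def by metis
  have fin: "finite B"
    using B by (auto simp: orthonormal_basis_def intro: pairwise_orthogonal_imp_finite)
  have orth: "q \<bullet> b = 0" "Vfield q \<bullet> b = 0" if "b \<in> B" for b
  proof -
    have "b \<in> horizontal q" using B that span_base unfolding orthonormal_basis_def by blast
    then show "q \<bullet> b = 0" "Vfield q \<bullet> b = 0"
      by (auto simp: horizontal_def tangent_def inner_commute)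
  qed
  have V: "Vfield q \<bullet> Vfield q = 1" by (simp add: Vfield_inner_Vfield q)
  have notin: "q \<notin> insert (Vfield q) B" "Vfield q \<notin> B"
    using orth q V inner_Vfield_self(1)[of q] by (metis insertE zero_neq_one)+
  let ?C = "insert q (insert (Vfield q) B)"
  have "y \<in> span ?C" for y
  proof -
    \<comment> \<open>The horizontal part of \<open>y\<close>.\<close>
    define h where "h = y - (y \<bullet> q) *\<^sub>R q - (y \<bullet> Vfield q) *\<^sub>R Vfield q"
    have "h \<in> horizontal q"
      by (simp add: h_def horizontal_def tangent_def inner_diff q V inner_commute)
    then have "h \<in> span ?C"
      using B span_mono[of B ?C] unfolding orthonormal_basis_def by blast
    then have "h + (y \<bullet> q) *\<^sub>R q + (y \<bullet> Vfield q) *\<^sub>R Vfield q \<in> span ?C"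
      by (intro span_add span_scale) (auto intro: span_base)
    then show ?thesis by (simp add: h_def)
  qed
  then have C: "orthonormal_basis ?C UNIV"
    using B orth q V
    by (auto simp: orthonormal_basis_def pairwise_insert orthogonal_def norm_eq_1 inner_commute)
  have "orthonormal_basis (Basis :: (complex ^ 'n) set) UNIV"
    by (auto simp: orthonormal_basis_def pairwise_def orthogonal_def inner_Basis)
  from orthonormal_basis_sum_squares[OF this C, of l]
  have "(\<Sum>b\<in>Basis. (blinfun_apply l b)\<^sup>2)
      = (blinfun_apply l (Vfield q))\<^sup>2 + (\<Sum>b\<in>B. (blinfun_apply l b)\<^sup>2)"
    using fin notin lq by simp
  moreover have "sR_hamiltonian (q, l) = 1/2 * (\<Sum>b\<in>B. (blinfun_apply l b)\<^sup>2)"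
    using orthonormal_basis_sum_squares[OF _ B]
      someI[where P = "\<lambda>B. orthonormal_basis B (horizontal q)", OF B]
    by (simp add: sR_hamiltonian_def)
  ultimately show ?thesis by (simp add: x)
qed

text \<open>Differentiate the polynomial expression in the ambient space and restrict; the transfer
  to \<open>sR_hamiltonian\<close> is made within the cotangent bundle, where the two are known to
  agree.\<close>

lemma sR_hamiltonian_has_derivative:
  fixes q m :: "complex ^ 'n::finite"
  assumes "(q, blinfun_inner_right m) \<in> cotangent_bundle"
  shows "(sR_hamiltonian has_derivative (\<lambda>\<eta>. blinfun_apply (snd \<eta>) m
      - (m \<bullet> Vfield q) * (blinfun_apply (snd \<eta>) (Vfield q) + m \<bullet> Vfield (fst \<eta>))))
    (at (q, blinfun_inner_right m) within cotangent_bundle)"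
proof (rule has_derivative_transform[OF assms sR_hamiltonian_on_cotangent_bundle])
  \<comment> \<open>Differentiating the squares produces this sum; it is \<open>l\<close> applied to
    the expansion of \<open>m\<close> in the standard basis.\<close>
  have m: "(\<Sum>b\<in>Basis. (m \<bullet> b) * blinfun_apply l b) = blinfun_apply l m" for l :: "_ \<Rightarrow>\<^sub>L real"
    by (subst (2) euclidean_representation[of m, symmetric])
      (simp only: blinfun.sum_right blinfun.scaleR_right real_scaleR_def)
  show "((\<lambda>x. 1/2 * ((\<Sum>b\<in>Basis. (blinfun_apply (snd x) b)\<^sup>2)
        - (blinfun_apply (snd x) (Vfield (fst x)))\<^sup>2)) has_derivative
      (\<lambda>\<eta>. blinfun_apply (snd \<eta>) m
        - (m \<bullet> Vfield q) * (blinfun_apply (snd \<eta>) (Vfield q) + m \<bullet> Vfield (fst \<eta>))))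
    (at (q, blinfun_inner_right m) within cotangent_bundle)"
    by (auto intro!: derivative_eq_intros bounded_linear.has_derivative[OF bounded_linear_Vfield]
        simp: m[symmetric] sum_distrib_left algebra_simps fun_eq_iff)
qed

text \<open>Differentiate the constraint that the base point has norm 1.\<close>

lemma velocities_cotangent_bundle_orthogonal:
  assumes "\<eta> \<in> velocities cotangent_bundle x"
  shows "fst x \<bullet> fst \<eta> = 0"
proof -
  obtain c where c: "\<And>s. c s \<in> cotangent_bundle" "c 0 = x" "(c has_vector_derivative \<eta>) (at 0)"
    using assms by (auto simp: velocities_def)
  have d: "((\<lambda>s. fst (c s)) has_vector_derivative fst \<eta>) (at 0)"
    using bounded_linear.has_vector_derivative[OF bounded_linear_fst c(3)] .
  have "(\<lambda>s. fst (c s) \<bullet> fst (c s)) = (\<lambda>_. 1)"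
    using c(1) by (auto simp: cotangent_bundle_def case_prod_beta norm_eq_1)
  then have "((\<lambda>s. 1) has_vector_derivative fst (c 0) \<bullet> fst \<eta> + fst \<eta> \<bullet> fst (c 0))
      (at (0::real))"
    using bounded_bilinear.has_vector_derivative[OF bounded_bilinear_inner d d] by simp
  then have "fst (c 0) \<bullet> fst \<eta> + fst \<eta> \<bullet> fst (c 0) = 0"
    using has_vector_derivative_const vector_derivative_unique_at by metis
  then show ?thesis by (simp add: c(2) inner_commute)
qed

text \<open>The coefficient \<open>r\<close> is arbitrary: covelocities are tested only against vectors tangent to the
  cotangent bundle, whose base component is orthogonal to \<open>\<gamma> t\<close>.\<close>

lemma normal_geodesicI:
  fixes \<gamma> m :: "real \<Rightarrow> complex ^ 'n::finite"
  assumes S: "\<And>t. \<gamma> t \<in> S" and orth: "\<And>t. m t \<bullet> \<gamma> t = 0"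
    and \<gamma>': "\<And>t. (\<gamma> has_vector_derivative m t - (m t \<bullet> Vfield (\<gamma> t)) *\<^sub>R Vfield (\<gamma> t)) (at t)"
    and m': "\<And>t. (m has_vector_derivative
      - r t *\<^sub>R \<gamma> t - (m t \<bullet> Vfield (\<gamma> t)) *\<^sub>R Vfield (m t)) (at t)"
  shows "normal_geodesic \<gamma>"
proof -
  let ?x = "\<lambda>t. (\<gamma> t, blinfun_inner_right (m t))"
  have x_in: "?x t \<in> cotangent_bundle" for t
    using S orth by (simp add: cotangent_bundle_def)
  have "hamiltonian_solution sR_hamiltonian ?x"
    unfolding hamiltonian_solution_def
  proof (intro allI conjI exI ballI)
    fix t
    show "?x t \<in> cotangent_bundle" by (rule x_in)
    show "(?x has_vector_derivative (m t - (m t \<bullet> Vfield (\<gamma> t)) *\<^sub>R Vfield (\<gamma> t),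
        blinfun_inner_right (- r t *\<^sub>R \<gamma> t - (m t \<bullet> Vfield (\<gamma> t)) *\<^sub>R Vfield (m t)))) (at t)"
      by (intro has_vector_derivative_Pair \<gamma>'
          bounded_linear.has_vector_derivative[OF bounded_linear_blinfun_inner_right m'])
    show "(sR_hamiltonian has_derivative (\<lambda>\<eta>. blinfun_apply (snd \<eta>) (m t)
        - (m t \<bullet> Vfield (\<gamma> t)) * (blinfun_apply (snd \<eta>) (Vfield (\<gamma> t)) + m t \<bullet> Vfield (fst \<eta>))))
      (at (?x t) within cotangent_bundle)"
      by (rule sR_hamiltonian_has_derivative[OF x_in])
    fix \<eta> assume "\<eta> \<in> velocities cotangent_bundle (?x t)"
    \<comment> \<open>The multiple of \<open>\<gamma> t\<close> in the covelocity pairs to zero with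
      \<open>fst \<eta>\<close>; skewness of \<open>Vfield\<close> moves it from
      \<open>fst \<eta>\<close> to \<open>m t\<close>, which matches the remaining terms.\<close>
    from velocities_cotangent_bundle_orthogonal[OF this]
    show "symplectic_form (?x t) (m t - (m t \<bullet> Vfield (\<gamma> t)) *\<^sub>R Vfield (\<gamma> t),
          blinfun_inner_right (- r t *\<^sub>R \<gamma> t - (m t \<bullet> Vfield (\<gamma> t)) *\<^sub>R Vfield (m t))) \<eta>
        = blinfun_apply (snd \<eta>) (m t)
          - (m t \<bullet> Vfield (\<gamma> t)) * (blinfun_apply (snd \<eta>) (Vfield (\<gamma> t)) + m t \<bullet> Vfield (fst \<eta>))"
      by (simp add: symplectic_form_eq inner_diff_left blinfun.diff_right blinfun.scaleR_right
          Vfield_skew[of "m t" "fst \<eta>"] algebra_simps)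
  qed
  then show ?thesis by (auto simp: normal_geodesic_def)
qed

section \<open>The rotated great circle\<close>

theorem corollary1:
  fixes n :: nat and p v :: "complex ^ 'n::finite" and \<gamma> :: "real \<Rightarrow> complex ^ 'n"
  assumes "n \<ge> 1" and "CARD('n) = n + 1"
    and "p \<in> S" and "v \<in> tangent p"
    and "\<And>t. \<gamma> t = (\<chi> k. great_circle p v t $ k * exp (- \<i> * complex_of_real (t * (v \<bullet> Vfield p))))"
  shows "(\<forall>\<delta>. horizontal_lift \<delta> (hopf \<circ> great_circle p v) \<and> \<delta> 0 = p \<longleftrightarrow> \<delta> = \<gamma>) \<and> normal_geodesic \<gamma>"
proof -
  define a where "a = v \<bullet> Vfield p"
  define u where "u t = cis (- (t * a))" for t
  define R where "R = great_circle p v"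
  \<comment> \<open>The velocity of \<open>R\<close>, in a form that also covers
    \<open>v = 0\<close>.\<close>
  define R' where "R' t = (- norm v * sin (norm v * t)) *\<^sub>R p + cos (norm v * t) *\<^sub>R v" for t
  define m where "m t = u t *s R' t" for t
  have p: "p \<bullet> p = 1" and pv: "p \<bullet> v = 0"
    using assms(3,4) by (auto simp: norm_eq_1 tangent_def)
  have vv: "v \<bullet> v = norm v * norm v"
    by (simp add: power2_norm_eq_inner flip: power2_eq_square)
  have u: "cmod (u t) = 1" for t by (simp add: u_def)
  have \<gamma>: "\<gamma> t = u t *s R t" for t
    by (simp add: assms(5) vec_eq_iff vector_scalar_mult_nth R_def u_def a_def cis_conv_exp
        mult.commute)
  \<comment> \<open>No case distinction remains: for \<open>v = 0\<close> the second summand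
    vanishes and the cosine is 1.\<close>
  have R: "R t = cos (norm v * t) *\<^sub>R p + (sin (norm v * t) / norm v) *\<^sub>R v" for t
    by (simp add: R_def great_circle_def)
  have R'R: "R' t \<bullet> R t = 0" for t
    by (cases "v = 0")
      (simp_all add: R R'_def inner_add inner_diff p pv vv inner_commute[of v p])
  \<comment> \<open>The pairings of \<open>p\<close> and of \<open>v\<close> with their own images
    under \<open>Vfield\<close> vanish. The other two terms carry the squares of sine and cosine,
    both with factor \<open>a\<close> by skewness.\<close>
  have R'V: "R' t \<bullet> Vfield (R t) = a" for t
  proof (cases "v = 0")
    case False
    have "p \<bullet> Vfield v = - a"
      by (simp add: Vfield_skew[of p v] a_def inner_commute)
    then have "R' t \<bullet> Vfield (R t) = ((sin (norm v * t))\<^sup>2 + (cos (norm v * t))\<^sup>2) * a"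
      using False
      by (simp add: R R'_def Vfield_add Vfield_scaleR inner_add inner_diff a_def power2_eq_square
          distrib_right del: sin_cos_squared_add)
    then show ?thesis by simp
  qed (simp add: R R'_def a_def)
  have dR: "(R has_vector_derivative R' t) (at t)" for t
    unfolding R[abs_def] R'_def
    by (cases "v = 0") (auto intro!: derivative_eq_intros
        simp: has_vector_derivative_def fun_eq_iff algebra_simps)
  \<comment> \<open>The geodesic equation of the round sphere: the ambient acceleration is
    normal.\<close>
  have dR': "(R' has_vector_derivative - (norm v)\<^sup>2 *\<^sub>R R t) (at t)" for t
    unfolding R R'_def[abs_def]
    by (auto intro!: derivative_eq_intros
        simp: has_vector_derivative_def fun_eq_iff algebra_simps power2_eq_square)
  have du: "(u has_vector_derivative - a *\<^sub>R (\<i> * u t)) (at t)" for t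
    using exp_scaleR_has_vector_derivative_left[of "- \<i> * complex_of_real a" t]
    by (simp add: u_def[abs_def] cis_conv_exp scaleR_conv_of_real mult_ac)
  have m\<gamma>: "m t \<bullet> \<gamma> t = 0" and mV: "m t \<bullet> Vfield (\<gamma> t) = a" for t
    by (simp_all add: m_def \<gamma> Vfield_mult inner_unit_mult u R'R R'V)
  \<comment> \<open>In the product rule, differentiating \<open>u\<close> gives the term with
    \<open>Vfield\<close>, since \<open>u\<close> rotates with speed \<open>-a\<close>; the other
    term is \<open>u t *s R' t\<close>. The computation for \<open>m\<close> has the same
    shape.\<close>
  have d\<gamma>: "(\<gamma> has_vector_derivative m t - a *\<^sub>R Vfield (\<gamma> t)) (at t)" for t
    unfolding \<gamma>[abs_def] m_def
    by (rule has_vector_derivative_eq_rhs[OF bounded_bilinear.has_vector_derivative[OF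
            bounded_bilinear_vector_scalar_mult du dR]])
      (simp add: vec_eq_iff vector_scalar_mult_nth Vfield_def algebra_simps
        scaleR_conv_of_real[of _ "_ :: complex"])
  have dm: "(m has_vector_derivative - (norm v)\<^sup>2 *\<^sub>R \<gamma> t - a *\<^sub>R Vfield (m t)) (at t)" for t
    unfolding \<gamma>[abs_def] m_def[abs_def]
    by (rule has_vector_derivative_eq_rhs[OF bounded_bilinear.has_vector_derivative[OF
            bounded_bilinear_vector_scalar_mult du dR']])
      (simp add: vec_eq_iff vector_scalar_mult_nth Vfield_def algebra_simps
        scaleR_conv_of_real[of _ "_ :: complex"])
  have R_S: "R t \<in> S" for t
  proof (cases "v = 0")
    case False
    then have "R t \<bullet> R t = 1"
      using sin_cos_squared_add[of "norm v * t"]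
      by (simp add: R inner_add p pv vv inner_commute[of v p] power2_eq_square)
    then show ?thesis by (simp add: norm_eq_1)
  qed (use assms(3) in \<open>simp add: R\<close>)
  then have \<gamma>_S: "\<gamma> t \<in> S" for t
    by (simp add: \<gamma> norm_unit_mult u)
  \<comment> \<open>The vertical component is \<open>a - a = 0\<close>, because
    \<open>Vfield (\<gamma> t)\<close> is a unit vector.\<close>
  have "m t - a *\<^sub>R Vfield (\<gamma> t) \<in> horizontal (\<gamma> t)" for t
    using \<gamma>_S[of t]
    by (simp add: horizontal_def tangent_def inner_diff m\<gamma> mV inner_commute[of "\<gamma> t" "m t"]
        Vfield_inner_Vfield norm_eq_1)
  then have "horizontal_curve \<gamma>"
    using \<gamma>_S d\<gamma> unfolding horizontal_curve_def by blast
  moreover have "hopf \<circ> \<gamma> = hopf \<circ> R"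
    by (simp add: fun_eq_iff \<gamma> hopf_unit_mult u)
  ultimately have lift: "horizontal_lift \<gamma> (hopf \<circ> R)"
    by (simp add: horizontal_lift_def)
  have "\<gamma> 0 = p"
    by (simp add: \<gamma> u_def R)
  then have "\<forall>\<delta>. horizontal_lift \<delta> (hopf \<circ> R) \<and> \<delta> 0 = p \<longleftrightarrow> \<delta> = \<gamma>"
    using lift horizontal_lift_unique by metis
  moreover have "normal_geodesic \<gamma>"
    using \<gamma>_S m\<gamma> d\<gamma> dm
    \<comment> \<open>The coefficient \<open>r\<close> is read off from the normal acceleration of
      the great circle, which the rotation carries to a multiple of
      \<open>\<gamma> t\<close>.\<close>
    by (intro normal_geodesicI[where m = m and r = "\<lambda>_. (norm v)\<^sup>2"]) (simp_all add: mV)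
  ultimately show ?thesis by (simp add: R_def)
qed

end
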